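(* For every graph $G$ with $n$ vertices and $m$ edges, $\mu(G)-\dfrac{2m}{n}\le\sqrt{s(G)}$.
   Context: $\mu(G)$ is the largest eigenvalue of the adjacency matrix of $G$; $s(G)=\sum_{u\in V(G)}\left|d(u)-\frac{2m}{n}\right|$, where $d(u)$ is the degree of $u$. *)

theory Defs
  imports "Jordan_Normal_Form.Char_Poly"
begin

locale simple_graph =
  fixes V :: "'a set" and E :: "'a set set"
  assumes finite_vertices: "finite V"
    and vertices_nonempty: "V \<noteq> {}"
    and edges_subset: "E \<subseteq> {e. e \<subseteq> V \<and> card e = 2}"

definition vertex_degree :: "'a set set \<Rightarrow> 'a \<Rightarrow> nat" where
  "vertex_degree E u = card {e \<in> E. u \<in> e}"

definition adjacency_matrix :: "'a list \<Rightarrow> 'a set set \<Rightarrow> real mat" where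
  "adjacency_matrix vs E =
     mat (length vs) (length vs) (\<lambda>(i, j). if {vs ! i, vs ! j} \<in> E then 1 else 0)"

definition enumeration :: "'a set \<Rightarrow> 'a list" where
  "enumeration V = (SOME vs. distinct vs \<and> set vs = V)"

(* The eigenvalues do not depend on the chosen enumeration, see eigenvalue_adjacency_matrix_enum. *)
definition largest_eigenvalue :: "'a set \<Rightarrow> 'a set set \<Rightarrow> real" where
  "largest_eigenvalue V E = Max {k. eigenvalue (adjacency_matrix (enumeration V) E) k}"

definition degree_deviation :: "'a set \<Rightarrow> 'a set set \<Rightarrow> real" where
  "degree_deviation V E =
     (\<Sum>u\<in>V. \<bar>real (vertex_degree E u) - 2 * real (card E) / real (card V)\<bar>)"

lemma enumeration:
  assumes "finite V"
  shows "distinct (enumeration V)" "set (enumeration V) = V"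
proof -
  have "\<exists>vs. distinct vs \<and> set vs = V"
    using finite_distinct_list[OF assms] by blast
  from someI_ex[OF this] show "distinct (enumeration V)" "set (enumeration V) = V"
    by (auto simp: enumeration_def)
qed

lemma eigenvalue_adjacency_matrix_iff:
  assumes "distinct vs"
  shows "eigenvalue (adjacency_matrix vs E) k \<longleftrightarrow>
    (\<exists>x. (\<exists>u\<in>set vs. x u \<noteq> 0) \<and>
         (\<forall>u\<in>set vs. (\<Sum>v\<in>set vs. (if {u, v} \<in> E then 1 else 0) * x v) = k * x u))"
    (is "?L \<longleftrightarrow> ?R")
proof -
  let ?n = "length vs"
  let ?A = "adjacency_matrix vs E"
  have dim [simp]: "dim_row ?A = ?n" "dim_col ?A = ?n"
    by (auto simp: adjacency_matrix_def)
  have mult: "(?A *\<^sub>v w) $ i = (\<Sum>v\<in>set vs. (if {vs ! i, v} \<in> E then 1 else 0) * x v)"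
    if "i < ?n" "dim_vec w = ?n" "\<And>j. j < ?n \<Longrightarrow> w $ j = x (vs ! j)" for i w x
  proof -
    have "(?A *\<^sub>v w) $ i = (\<Sum>j<?n. (if {vs ! i, vs ! j} \<in> E then 1 else 0) * x (vs ! j))"
      using that by (auto simp: adjacency_matrix_def scalar_prod_def lessThan_atLeast0 intro!: sum.cong)
    also have "\<dots> = (\<Sum>v\<in>set vs. (if {vs ! i, v} \<in> E then 1 else 0) * x v)"
      by (rule sum.reindex_bij_betw[OF bij_betw_nth[OF assms refl refl]])
    finally show ?thesis .
  qed
  show ?thesis
  proof
    assume ?L
    then obtain w where w: "dim_vec w = ?n" "w \<noteq> 0\<^sub>v ?n" "?A *\<^sub>v w = k \<cdot>\<^sub>v w"
      unfolding eigenvalue_def eigenvector_def dim by (metis carrier_vecD)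
    define x where "x u = w $ (inv_into {..<?n} ((!) vs) u)" for u
    have inj: "inj_on ((!) vs) {..<?n}"
      using assms by (auto simp: inj_on_def nth_eq_iff_index_eq)
    have x: "w $ j = x (vs ! j)" if "j < ?n" for j
      using that inj by (simp add: x_def)
    from w(1,2) obtain j where "j < ?n" "w $ j \<noteq> 0"
      by (metis eq_vecI index_zero_vec(1) index_zero_vec(2))
    then have "\<exists>u\<in>set vs. x u \<noteq> 0"
      using x by (metis nth_mem)
    moreover have "(\<Sum>v\<in>set vs. (if {u, v} \<in> E then 1 else 0) * x v) = k * x u"
      if "u \<in> set vs" for u
    proof -
      from that obtain i where i: "i < ?n" "u = vs ! i"
        by (metis in_set_conv_nth)
      show ?thesis
        using mult[OF i(1) w(1) x] i w(1,3) x by simp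
    qed
    ultimately show ?R by blast
  next
    assume ?R
    then obtain x where x: "\<exists>u\<in>set vs. x u \<noteq> 0"
      "\<forall>u\<in>set vs. (\<Sum>v\<in>set vs. (if {u, v} \<in> E then 1 else 0) * x v) = k * x u"
      by blast
    define w where "w = vec ?n (\<lambda>i. x (vs ! i))"
    have dw: "dim_vec w = ?n" and wi: "\<And>j. j < ?n \<Longrightarrow> w $ j = x (vs ! j)"
      by (auto simp: w_def)
    from x(1) obtain i where "i < ?n" "x (vs ! i) \<noteq> 0"
      by (metis in_set_conv_nth)
    then have "w \<noteq> 0\<^sub>v ?n"
      using wi by (metis index_zero_vec(1))
    moreover have "?A *\<^sub>v w = k \<cdot>\<^sub>v w"
    proof (rule eq_vecI)
      fix i assume "i < dim_vec (k \<cdot>\<^sub>v w)"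
      then have i: "i < ?n" by (simp add: dw)
      show "(?A *\<^sub>v w) $ i = (k \<cdot>\<^sub>v w) $ i"
        using mult[OF i dw wi] x(2) i dw wi by simp
    qed (simp add: dw)
    ultimately show ?L
      using dw by (auto simp: eigenvalue_def eigenvector_def intro!: exI[of _ w] carrier_vecI)
  qed
qed

lemma eigenvalue_adjacency_matrix_enum:
  assumes "distinct vs" "set vs = V"
  shows "eigenvalue (adjacency_matrix vs E) k \<longleftrightarrow>
         eigenvalue (adjacency_matrix (enumeration V) E) k"
proof -
  have "finite V" using assms(2) by auto
  then show ?thesis
    using assms by (simp add: eigenvalue_adjacency_matrix_iff enumeration)
qed

end

theory Submission
  imports Defs "Jordan_Normal_Form.Spectral_Radius"
begin

text \<open>
  Let \<open>A\<close> be the adjacency matrix, \<open>d = 2m/n\<close>, and let \<open>x\<close> be an eigenvector for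
  \<open>k > d\<close>. Put \<open>y = |x|\<close>, \<open>z = A y\<close> and write \<open>Y\<close>, \<open>Z\<close> for the sums of their entries.
  The triangle inequality gives \<open>z \<ge> k y\<close>, whence \<open>A z \<ge> k z\<close>. Summing all entries
  of \<open>A z\<close> by columns gives \<open>(\<Sum>v. z v (deg v - d)) \<ge> (k - d) Z \<ge> (k - d) k Y\<close>, while
  \<open>z \<le> Y\<close> entrywise bounds the left-hand side by \<open>Y s(G)\<close>. Hence
  \<open>(k - d)\<^sup>2 \<le> (k - d) k \<le> s(G)\<close>. Working with \<open>|x|\<close> makes Perron--Frobenius theory
  unnecessary.
\<close>

text \<open>Weights keep the estimate free of graph notions: with \<open>a\<close> the adjacency
  indicator the row sums are the degrees, and \<open>d\<close> becomes the average degree.\<close>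

lemma eigenvalue_minus_le_sqrt_row_sum_deviation:
  fixes a :: "'a \<Rightarrow> 'a \<Rightarrow> real"
  assumes fin: "finite V"
    and sym: "\<And>u v. u \<in> V \<Longrightarrow> v \<in> V \<Longrightarrow> a u v = a v u"
    and a_nonneg: "\<And>u v. u \<in> V \<Longrightarrow> v \<in> V \<Longrightarrow> 0 \<le> a u v"
    and a_le_1: "\<And>u v. u \<in> V \<Longrightarrow> v \<in> V \<Longrightarrow> a u v \<le> 1"
    and w: "w \<in> V" "x w \<noteq> 0"
    and eig: "\<And>u. u \<in> V \<Longrightarrow> (\<Sum>v\<in>V. a u v * x v) = k * x u"
    and d: "0 \<le> d"
  shows "k - d \<le> sqrt (\<Sum>u\<in>V. \<bar>(\<Sum>v\<in>V. a u v) - d\<bar>)"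
proof (cases "k \<le> d")
  case True
  then show ?thesis
    by (meson abs_ge_zero diff_le_0_iff_le order_trans real_sqrt_ge_zero sum_nonneg)
next
  case False
  define y where "y v = \<bar>x v\<bar>" for v
  define z where "z u = (\<Sum>v\<in>V. a u v * y v)" for u
  define Y where "Y = (\<Sum>v\<in>V. y v)"
  define r where "r u = (\<Sum>v\<in>V. a u v)" for u
  have kpos: "k > 0" using False d by simp
  have Ypos: "Y > 0"
    unfolding Y_def using fin w by (intro sum_pos2[of V w]) (auto simp: y_def)
  have z_ge: "k * y u \<le> z u" if "u \<in> V" for u
  proof -
    have "k * y u = \<bar>\<Sum>v\<in>V. a u v * x v\<bar>"
      using eig[OF that] kpos by (simp add: y_def abs_mult)
    also have "\<dots> \<le> (\<Sum>v\<in>V. \<bar>a u v * x v\<bar>)" by (rule sum_abs)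
    also have "\<dots> = z u"
      unfolding z_def y_def using a_nonneg that by (intro sum.cong) (auto simp: abs_mult)
    finally show ?thesis .
  qed
  have z_nonneg: "0 \<le> z u" if "u \<in> V" for u
    unfolding z_def using a_nonneg that by (auto intro!: sum_nonneg simp: y_def)
  have z_le: "z u \<le> Y" if "u \<in> V" for u
    unfolding z_def Y_def
    using a_le_1 that by (intro sum_mono) (auto simp: y_def intro: mult_left_le_one_le a_nonneg)
  have "k * Y \<le> (\<Sum>u\<in>V. z u)"
    unfolding Y_def sum_distrib_left by (intro sum_mono z_ge)
  then have "(k - d) * (k * Y) \<le> (k - d) * (\<Sum>u\<in>V. z u)"
    using False by (intro mult_left_mono) auto
  also have "\<dots> \<le> (\<Sum>v\<in>V. z v * (r v - d))"
  proof -
    have "k * (\<Sum>u\<in>V. z u) = (\<Sum>u\<in>V. \<Sum>v\<in>V. a u v * (k * y v))"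
      by (simp add: z_def sum_distrib_left algebra_simps)
    \<comment> \<open>Second use of \<open>z_ge\<close>: nonnegative weights carry
      \<open>k * y \<le> z\<close> over to \<open>k * z \<le> A z\<close>, here already summed over
      all rows.\<close>
    also have "\<dots> \<le> (\<Sum>u\<in>V. \<Sum>v\<in>V. a u v * z v)"
      by (intro sum_mono mult_left_mono z_ge a_nonneg)
    also have "\<dots> = (\<Sum>v\<in>V. \<Sum>u\<in>V. a u v * z v)" by (rule sum.swap)
    \<comment> \<open>By symmetry the column sums are the row sums \<open>r\<close>.\<close>
    also have "\<dots> = (\<Sum>v\<in>V. z v * r v)"
      using sym by (auto simp: r_def sum_distrib_left mult.commute intro!: sum.cong)
    finally show ?thesis
      by (simp add: algebra_simps sum_subtractf sum_distrib_left)
  qed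
  also have "\<dots> \<le> (\<Sum>v\<in>V. Y * \<bar>r v - d\<bar>)"
  proof (intro sum_mono)
    fix v assume "v \<in> V"
    \<comment> \<open>The factor \<open>r v - d\<close> may be negative, so the absolute value is
      taken before \<open>z v\<close> is raised to \<open>Y\<close>.\<close>
    have "z v * (r v - d) \<le> z v * \<bar>r v - d\<bar>"
      by (intro mult_left_mono z_nonneg \<open>v \<in> V\<close>) simp
    also have "\<dots> \<le> Y * \<bar>r v - d\<bar>"
      by (intro mult_right_mono z_le \<open>v \<in> V\<close>) simp
    finally show "z v * (r v - d) \<le> Y * \<bar>r v - d\<bar>" .
  qed
  also have "\<dots> = (\<Sum>v\<in>V. \<bar>r v - d\<bar>) * Y"
    by (simp add: sum_distrib_left mult.commute)
  finally have "(k - d) * k \<le> (\<Sum>v\<in>V. \<bar>r v - d\<bar>)"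
    using Ypos by (simp flip: mult.assoc)
  \<comment> \<open>Here \<open>k - d \<le> k\<close> because \<open>d \<ge> 0\<close>.\<close>
  moreover have "(k - d)\<^sup>2 \<le> (k - d) * k"
    unfolding power2_eq_square using False d by (intro mult_left_mono) auto
  ultimately show ?thesis
    unfolding r_def by (intro real_le_rsqrt) linarith
qed

text \<open>Over the complex numbers some eigenvalue exists; the Hermitian argument makes it real,
  and it is then a root of the real characteristic polynomial.\<close>

lemma symmetric_real_mat_has_eigenvalue:
  fixes A :: "real mat"
  assumes A: "A \<in> carrier_mat n n" and n: "n > 0" and sym: "A\<^sup>T = A"
  shows "\<exists>k. eigenvalue A k"
proof -
  let ?C = "map_mat complex_of_real A"
  have C: "?C \<in> carrier_mat n n" using A by simp
  from spectrum_non_empty[OF C n] obtain k where k: "eigenvalue ?C k"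
    by (auto simp: spectrum_def)
  then obtain v where v: "v \<in> carrier_vec n" "v \<noteq> 0\<^sub>v n" "?C *\<^sub>v v = k \<cdot>\<^sub>v v"
    using C unfolding eigenvalue_def eigenvector_def by auto
  have symC: "?C\<^sup>T = ?C" using map_mat_transpose[of complex_of_real A] sym by simp
  have conj: "?C *\<^sub>v conjugate v = conjugate (?C *\<^sub>v v)"
    using A v(1) by (intro eq_vecI) (auto simp: scalar_prod_def)
  \<comment> \<open>Evaluate the Hermitian form at \<open>v\<close> twice, moving the matrix across
    by symmetry; its entries are real, so \<open>conjugate v\<close> belongs to
    \<open>cnj k\<close>.\<close>
  have "k * (v \<bullet>c v) = (?C *\<^sub>v v) \<bullet>c v"
    using v by simp
  also have "\<dots> = v \<bullet> (?C *\<^sub>v conjugate v)"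
    using transpose_vec_mult_scalar[OF C, of "conjugate v" v] v(1) C symC
    by simp
  also have "\<dots> = cnj k * (v \<bullet>c v)"
    using v by (simp add: conj conjugate_smult_vec)
  finally have "k = cnj k"
    using conjugate_square_eq_0_vec[OF v(1)] v(2) by simp
  then have "k = of_real (Re k)"
    by (metis Reals_cnj_iff of_real_Re)
  moreover have "poly (map_poly of_real (char_poly A)) k = 0"
    using k eigenvalue_root_char_poly[OF C] of_real_hom.char_poly_hom[OF A] by metis
  ultimately have "poly (char_poly A) (Re k) = 0"
    by (metis of_real_hom.poly_map_poly of_real_eq_0_iff)
  then show ?thesis
    using eigenvalue_root_char_poly[OF A] by blast
qed

lemma (in simple_graph) vertex_degree_eq_sum:
  assumes "u \<in> V"
  shows "real (vertex_degree E u) = (\<Sum>v\<in>V. if {u, v} \<in> E then 1 else 0)"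
proof -
  \<comment> \<open>Neighbours correspond to incident edges, since every edge has exactly two
    elements.\<close>
  have "bij_betw (\<lambda>v. {u, v}) {v \<in> V. {u, v} \<in> E} {e \<in> E. u \<in> e}"
  proof (rule bij_betwI')
    fix e assume e: "e \<in> {e \<in> E. u \<in> e}"
    then have "card e = 2" "e \<subseteq> V" using edges_subset by auto
    then obtain p q where "e = {p, q}" by (auto simp: card_2_iff)
    with e \<open>e \<subseteq> V\<close> show "\<exists>v\<in>{v \<in> V. {u, v} \<in> E}. e = {u, v}"
      by (auto simp: insert_commute)
  qed (auto simp: doubleton_eq_iff)
  then have "vertex_degree E u = card {v \<in> V. {u, v} \<in> E}"
    unfolding vertex_degree_def by (rule bij_betw_same_card[symmetric])
  then show ?thesis
    using finite_vertices by (simp add: sum.If_cases Int_def)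
qed

text \<open>\<open>Max\<close> is attained because the set of real eigenvalues is finite and, by
  symmetry of the matrix, nonempty.\<close>

lemma (in simple_graph) eigenvalue_largest_eigenvalue:
  "eigenvalue (adjacency_matrix (enumeration V) E) (largest_eigenvalue V E)"
proof -
  let ?vs = "enumeration V"
  let ?A = "adjacency_matrix ?vs E"
  have A: "?A \<in> carrier_mat (length ?vs) (length ?vs)"
    by (simp add: adjacency_matrix_def)
  have "length ?vs > 0"
    using enumeration(2)[OF finite_vertices] vertices_nonempty by auto
  moreover have "?A\<^sup>T = ?A"
    by (auto simp: adjacency_matrix_def insert_commute)
  ultimately have "{k. eigenvalue ?A k} \<noteq> {}"
    using symmetric_real_mat_has_eigenvalue[OF A] by blast
  moreover have "finite {k. eigenvalue ?A k}"
    using card_finite_spectrum(1)[OF A] by (simp add: spectrum_def)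
  ultimately show ?thesis
    unfolding largest_eigenvalue_def using Max_in by blast
qed

theorem theorem8:
  fixes V :: "'a set" and E :: "'a set set" and n m :: nat
  assumes "simple_graph V E"
    and "card V = n"
    and "card E = m"
  shows "largest_eigenvalue V E - 2 * real m / real n \<le> sqrt (degree_deviation V E)"
proof -
  interpret simple_graph V E by fact
  let ?a = "\<lambda>u v. if {u, v} \<in> E then 1 else (0 :: real)"
  obtain x w where "w \<in> V" "x w \<noteq> 0"
    and "\<And>u. u \<in> V \<Longrightarrow> (\<Sum>v\<in>V. ?a u v * x v) = largest_eigenvalue V E * x u"
    using eigenvalue_largest_eigenvalue
    unfolding eigenvalue_adjacency_matrix_iff[OF enumeration(1)[OF finite_vertices]]
      enumeration(2)[OF finite_vertices]
    by blast
  then have "largest_eigenvalue V E - 2 * real m / real n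
      \<le> sqrt (\<Sum>u\<in>V. \<bar>(\<Sum>v\<in>V. ?a u v) - 2 * real m / real n\<bar>)"
    by (intro eigenvalue_minus_le_sqrt_row_sum_deviation[where x = x and w = w])
      (auto simp: finite_vertices insert_commute)
  also have "(\<Sum>u\<in>V. \<bar>(\<Sum>v\<in>V. ?a u v) - 2 * real m / real n\<bar>) = degree_deviation V E"
    using assms(2,3) by (simp add: degree_deviation_def vertex_degree_eq_sum)
  finally show ?thesis .
qed

end
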